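(* Let $n\ge 1$. A matrix $A \in M_n(\mathbb{T})$ over the extended tropical semiring is pseudo invertible if and only if it is tropically regular. Moreover, if $A$ is tropically regular, then the matrix $$\frac{\mathrm{Adj}(A)}{|A|}$$ is a pseudo inverse matrix of $A$.
   Context: Extended tropical semiring. Let $\mathbb{R}^\nu=\{a^\nu : a\in\mathbb{R}\}$ be a disjoint copy of $\mathbb{R}$, let $-\infty$ be a formal element, and put $\mathbb{T}=\mathbb{R}\cup\{-\infty\}\cup\mathbb{R}^\nu$ (disjoint union), $\bar{\mathbb{R}}^\nu=\mathbb{R}^\nu\cup\{-\infty\}$. Order $\prec$ on $\mathbb{T}$: $-\infty\prec x$ for all $x\ne-\infty$; for real $a<b$: $a\prec b$, $a\prec b^\nu$, $a^\nu\prec b$, $a^\nu\prec b^\nu$; and $a\prec a^\nu$ for all $a\in\mathbb{R}$. Addition $\oplus$: $-\infty\oplus x=x\oplus-\infty=x$; $x\oplus y=\max_\prec\{x,y\}$ if $x\neq y$; $a\oplus a=a^\nu\oplus a^\nu=a^\nu$ for $a\in\mathbb{R}$. Multiplication $\odot$ (written as juxtaposition): $-\infty\odot x=x\odot-\infty=-\infty$; $a\odot b=a+b$ for $a,b\in\mathbb{R}$; $a^\nu\odot b=a\odot b^\nu=a^\nu\odot b^\nu=(a+b)^\nu$. This is a commutative semiring with zero $-\infty$ and unit the real number $0$. $M_n(\mathbb{T})$ is the semiring of $n\times n$ matrices over $\mathbb{T}$ with the usual matrix operations induced from $\oplus,\odot$. The tropical determinant of $A=(a_{ij})$ is $|A|=\bigoplus_{\sigma\in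 S_n} a_{1\sigma(1)}\odot\cdots\odot a_{n\sigma(n)}$. $A$ is tropically singular if $|A|\in\bar{\mathbb{R}}^\nu$, and tropically regular otherwise (i.e. if $|A|\in\mathbb{R}$). The minor $A_{ij}$ is obtained from $A$ by deleting row $i$ and column $j$ (the determinant of the empty matrix is $0$), and $\mathrm{Adj}(A)$ is the transpose of the matrix $(|A_{ij}|)$, i.e. its $(i,j)$ entry is $|A_{ji}|$. For $A$ regular, $\mathrm{Adj}(A)/|A|$ is the matrix obtained by multiplying ($\odot$) every entry of $\mathrm{Adj}(A)$ by the real number $-|A|$. A pseudo unit matrix is a tropically regular matrix in $M_n(\mathbb{T})$ all of whose diagonal entries equal the real number $0$ and all of whose off-diagonal entries lie in $\bar{\mathbb{R}}^\nu$; $U_n(\mathbb{T})$ is the set of all pseudo unit matrices. A matrix $A\in M_n(\mathbb{T})$ is pseudo invertible if there exists $B\in M_n(\mathbb{T})$ with $AB\in U_n(\mathbb{T})$ and $BA\in U_n(\mathbb{T})$; any such $B$ is called a pseudo inverse matrix of $A$. *)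

theory Defs
  imports "Jordan_Normal_Form.Determinant"
begin

section \<open>The extended tropical semiring\<close>

datatype trop = MInf | Tang (tang_val: real) | Ghost real

text \<open>\<open>Tang a\<close> is the real number \<open>a\<close>, \<open>Ghost a\<close> is its copy \<open>a\<^sup>\<nu>\<close>, and \<open>MInf\<close> is
  \<open>-\<infinity>\<close>. The selector \<open>tang_val\<close> is meaningful on \<open>Tang\<close> only and unspecified elsewhere.\<close>

definition ghost0 :: "trop set" where
  "ghost0 = insert MInf (range Ghost)"

instantiation trop :: linorder
begin

fun less_trop :: "trop \<Rightarrow> trop \<Rightarrow> bool" where
  "MInf < y \<longleftrightarrow> y \<noteq> MInf"
| "Tang a < MInf \<longleftrightarrow> False"
| "Tang a < Tang b \<longleftrightarrow> a < b"
| "Tang a < Ghost b \<longleftrightarrow> a < b \<or> a = b"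
| "Ghost a < MInf \<longleftrightarrow> False"
| "Ghost a < Tang b \<longleftrightarrow> a < b"
| "Ghost a < Ghost b \<longleftrightarrow> a < b"

definition less_eq_trop :: "trop \<Rightarrow> trop \<Rightarrow> bool" where
  "x \<le> y \<longleftrightarrow> x < y \<or> x = (y :: trop)"

instance
proof
  fix x y z :: trop
  show "x < y \<longleftrightarrow> x \<le> y \<and> \<not> y \<le> x"
    by (cases x; cases y) (auto simp: less_eq_trop_def)
  show "x \<le> x"
    by (simp add: less_eq_trop_def)
  show "x \<le> y \<Longrightarrow> y \<le> z \<Longrightarrow> x \<le> z"
    by (cases x; cases y; cases z) (auto simp: less_eq_trop_def)
  show "x \<le> y \<Longrightarrow> y \<le> x \<Longrightarrow> x = y"
    by (cases x; cases y) (auto simp: less_eq_trop_def)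
  show "x \<le> y \<or> y \<le> x"
    by (cases x; cases y) (auto simp: less_eq_trop_def)
qed

end

text \<open>The class constants denote the tropical structure: \<open>+\<close> is \<open>\<oplus>\<close>, \<open>*\<close> is \<open>\<odot>\<close>,
  the constant \<open>0\<close> is \<open>-\<infinity>\<close> and \<open>1\<close> is the real number zero, \<open>Tang 0\<close>.
  Hence \<open>\<Sum>\<close>, \<open>\<Prod>\<close> and the matrix product are the tropical ones.\<close>

instantiation trop :: comm_semiring_1
begin

definition zero_trop :: trop where
  "0 = MInf"

definition one_trop :: trop where
  "1 = Tang 0"

fun plus_trop :: "trop \<Rightarrow> trop \<Rightarrow> trop" where
  "MInf + y = y"
| "x + MInf = x"
| "Tang a + Tang b = (if a = b then Ghost a else max (Tang a) (Tang b))"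
| "Ghost a + Ghost b = (if a = b then Ghost a else max (Ghost a) (Ghost b))"
| "Tang a + Ghost b = max (Tang a) (Ghost b)"
| "Ghost a + Tang b = max (Ghost a) (Tang b)"

fun times_trop :: "trop \<Rightarrow> trop \<Rightarrow> trop" where
  "MInf * y = MInf"
| "x * MInf = MInf"
| "Tang a * Tang b = Tang (a + b)"
| "Ghost a * Tang b = Ghost (a + b)"
| "Tang a * Ghost b = Ghost (a + b)"
| "Ghost a * Ghost b = Ghost (a + b)"

instance
proof
  fix x y z :: trop
  show "x + y + z = x + (y + z)"
    by (cases x; cases y; cases z) (auto simp: max_def less_eq_trop_def)
  show "x + y = y + x"
    by (cases x; cases y) (auto simp: max_def less_eq_trop_def)
  show "0 + x = x"
    by (simp add: zero_trop_def)
  show "x * y * z = x * (y * z)"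
    by (cases x; cases y; cases z) (auto simp: add.assoc)
  show "x * y = y * x"
    by (cases x; cases y) (auto simp: add.commute)
  show "1 * x = x"
    by (cases x) (auto simp: one_trop_def)
  show "(x + y) * z = x * z + y * z"
    by (cases x; cases y; cases z) (auto simp: max_def less_eq_trop_def)
  show "0 * x = 0" "x * 0 = 0"
    by (cases x; simp add: zero_trop_def)+
  show "(0 :: trop) \<noteq> 1"
    by (simp add: zero_trop_def one_trop_def)
qed

end

section \<open>Tropical matrices\<close>

text \<open>The library's \<open>det\<close> and \<open>adj_mat\<close> carry signs and need a commutative ring, so the
  sign-free tropical versions are defined here. Indices run over \<open>{0..<n}\<close>, and the functions
  are meant for square matrices. \<open>mat_delete A i j\<close> removes row \<open>i\<close> and column \<open>j\<close>.\<close>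

definition trop_det :: "trop mat \<Rightarrow> trop" where
  "trop_det A = (\<Sum>\<sigma> | \<sigma> permutes {0..<dim_row A}. \<Prod>i = 0..<dim_row A. A $$ (i, \<sigma> i))"

definition trop_singular :: "trop mat \<Rightarrow> bool" where
  "trop_singular A \<longleftrightarrow> trop_det A \<in> ghost0"

definition trop_regular :: "trop mat \<Rightarrow> bool" where
  "trop_regular A \<longleftrightarrow> \<not> trop_singular A"

definition trop_adj :: "trop mat \<Rightarrow> trop mat" where
  "trop_adj A = mat (dim_row A) (dim_col A) (\<lambda>(i, j). trop_det (mat_delete A j i))"

text \<open>\<open>Adj(A) / |A|\<close>, meaningful for regular \<open>A\<close>, where \<open>|A|\<close> is a real number.\<close>

definition trop_adj_div_det :: "trop mat \<Rightarrow> trop mat" where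
  "trop_adj_div_det A = Tang (- tang_val (trop_det A)) \<cdot>\<^sub>m trop_adj A"

definition pseudo_units :: "nat \<Rightarrow> trop mat set" where
  "pseudo_units n = {U \<in> carrier_mat n n. trop_regular U \<and>
     (\<forall>i<n. U $$ (i, i) = Tang 0) \<and>
     (\<forall>i<n. \<forall>j<n. i \<noteq> j \<longrightarrow> U $$ (i, j) \<in> ghost0)}"

definition pseudo_inverse :: "nat \<Rightarrow> trop mat \<Rightarrow> trop mat \<Rightarrow> bool" where
  "pseudo_inverse n A B \<longleftrightarrow>
     B \<in> carrier_mat n n \<and> A * B \<in> pseudo_units n \<and> B * A \<in> pseudo_units n"

definition pseudo_invertible :: "nat \<Rightarrow> trop mat \<Rightarrow> bool" where
  "pseudo_invertible n A \<longleftrightarrow> (\<exists>B. pseudo_inverse n A B)"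

lemma trop_regular_iff: "trop_regular A \<longleftrightarrow> trop_det A \<in> range Tang"
  by (cases "trop_det A") (auto simp: trop_regular_def trop_singular_def ghost0_def)

end

theory Submission
  imports Defs "HOL-Combinatorics.Cycles"
begin

text \<open>
  Pseudo invertibility forces regularity through a weak form of multiplicativity. Expanding the
  permanent of a product \<open>A B\<close> over all maps of indices, the bijective maps contribute
  \<open>|A| |B|\<close>, and every other map contributes a permanent with two equal rows, whose terms are
  equal in pairs (\<open>permanent_mult\<close>). In the tropical semiring the multiples of \<open>2\<close> are
  exactly the ghosts and \<open>-\<infinity>\<close>, so \<open>|A B|\<close> can only be a real number if \<open>|A| |B|\<close> is the same real
  number, and then \<open>|A|\<close> is real (\<open>trop_regular_factor\<close>).

  Conversely let \<open>|A| = d\<close> be real. By the Laplace expansion, the entry \<open>(i, k)\<close> of \<open>A Adj(A)\<close> is the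
  determinant of \<open>A\<close> with row \<open>k\<close> replaced by row \<open>i\<close>: this is \<open>|A|\<close> on the diagonal, and elsewhere
  a determinant with two equal rows, hence a ghost or \<open>-\<infinity>\<close>. The remaining point is that the quotient
  \<open>U\<close> by \<open>|A|\<close> is regular, that is, that the identity is the only permutation of maximal weight
  in \<open>|U|\<close>. Regularity of \<open>A\<close> says that exactly one permutation \<open>\<pi>\<close> attains the maximum \<open>d\<close>
  and that it does so with real entries. Strict complementarity for the assignment problem then gives
  real potentials \<open>u\<close>, \<open>v\<close> such that the entry \<open>a\<^sub>i\<^sub>j\<close> is \<open>u\<^sub>i + v\<^sub>j\<close> for \<open>j = \<pi> i\<close> and lies
  strictly below \<open>u\<^sub>i + v\<^sub>j\<close> otherwise (\<open>assignment_potentials\<close>). No permutation follows \<open>\<pi>\<close> in every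
  row of a matrix with a repeated row, so the entry \<open>(i, k)\<close> of \<open>U\<close> with \<open>i \<noteq> k\<close> lies strictly
  below \<open>u\<^sub>i - u\<^sub>k\<close> (\<open>replaced_row_permanent_less\<close>). Along a permutation these bounds
  telescope to \<open>0\<close>, so every permutation other than the identity has weight below \<open>0\<close>.

  The product in the other order is handled by transposition.
\<close>

section \<open>Permanents over a commutative semiring\<close>

definition permanent :: "nat \<Rightarrow> (nat \<Rightarrow> nat \<Rightarrow> 'a::comm_semiring_1) \<Rightarrow> 'a" where
  "permanent n f = (\<Sum>\<sigma> | \<sigma> permutes {0..<n}. \<Prod>i = 0..<n. f i (\<sigma> i))"

lemma permanent_cong:
  assumes "\<And>i j. i < n \<Longrightarrow> j < n \<Longrightarrow> f i j = g i j"
  shows "permanent n f = permanent n g"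
  unfolding permanent_def
proof (intro sum.cong prod.cong refl)
  fix \<sigma> i assume "\<sigma> \<in> {\<sigma>. \<sigma> permutes {0..<n}}" "i \<in> {0..<n}"
  then have "i < n" "\<sigma> i < n" using permutes_in_image[of \<sigma> "{0..<n}" i] by auto
  then show "f i (\<sigma> i) = g i (\<sigma> i)" by (rule assms)
qed

lemma permanent_permute_rows:
  assumes "\<pi> permutes {0..<n}"
  shows "permanent n (\<lambda>i. f (\<pi> i)) = permanent n f"
proof -
  have "(\<Prod>i = 0..<n. f (\<pi> i) ((\<sigma> \<circ> \<pi>) i)) = (\<Prod>i = 0..<n. f i (\<sigma> i))" for \<sigma>
    using prod.permute[OF assms, of "\<lambda>i. f i (\<sigma> i)"] by (simp add: o_def)
  then show ?thesis
    unfolding permanent_def using sum_permutations_compose_right[OF assms,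
        of "\<lambda>\<sigma>. \<Prod>i = 0..<n. f (\<pi> i) (\<sigma> i)"] by simp
qed

lemma permanent_transpose: "permanent n (\<lambda>i j. f j i) = permanent n f"
proof -
  have "(\<Prod>i = 0..<n. f (inv_into UNIV \<sigma> i) i) = (\<Prod>i = 0..<n. f i (\<sigma> i))"
    if "\<sigma> permutes {0..<n}" for \<sigma>
    using prod.permute[OF that, of "\<lambda>i. f (inv_into UNIV \<sigma> i) i"] permutes_inverses[OF that]
    by (simp add: o_def)
  then show ?thesis
    unfolding permanent_def
    by (subst sum_permutations_inverse) (auto intro!: sum.cong)
qed

text \<open>Composing a permutation with the transposition of the two equal rows does not change its term,
  so the terms come in equal pairs, one with \<open>\<sigma> i < \<sigma> k\<close> and one with \<open>\<sigma> i > \<sigma> k\<close>. In the absence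
  of signs the pairs add up instead of cancelling.\<close>

lemma two_dvd_permanent_equal_rows:
  assumes ik: "i < n" "k < n" "i \<noteq> k" and eq: "\<And>j. j < n \<Longrightarrow> f i j = f k j"
  shows "2 dvd permanent n f"
proof -
  let ?N = "{0..<n}" and ?t = "Transposition.transpose i k"
  let ?P = "{\<sigma>. \<sigma> permutes ?N}"
  let ?L = "{\<sigma>. \<sigma> permutes ?N \<and> \<sigma> i < \<sigma> k}" and ?G = "{\<sigma>. \<sigma> permutes ?N \<and> \<sigma> k < \<sigma> i}"
  let ?F = "\<lambda>\<sigma>. \<Prod>r = 0..<n. f r (\<sigma> r)"
  have t: "?t permutes ?N" using ik by (intro permutes_swap_id) auto
  have swap: "?F (\<sigma> \<circ> ?t) = ?F \<sigma>" if "\<sigma> permutes ?N" for \<sigma>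
  proof -
    have "?F \<sigma> = (\<Prod>r = 0..<n. f (?t r) (\<sigma> (?t r)))"
      using prod.permute[OF t, of "\<lambda>r. f r (\<sigma> r)"] by (simp add: o_def)
    also have "\<dots> = ?F (\<sigma> \<circ> ?t)"
    proof (intro prod.cong refl)
      fix r assume "r \<in> ?N"
      then have "\<sigma> (?t r) < n"
        using permutes_in_image[OF t, of r] permutes_in_image[OF that, of "?t r"] by auto
      then show "f (?t r) (\<sigma> (?t r)) = f r ((\<sigma> \<circ> ?t) r)"
        using eq by (auto simp: Transposition.transpose_def)
    qed
    finally show ?thesis by simp
  qed
  have distinct: "\<sigma> i \<noteq> \<sigma> k" if "\<sigma> permutes ?N" for \<sigma>
    using ik(3) inj_eq[OF permutes_inj[OF that], of i k] by simp
  have split: "?P = ?L \<union> ?G"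
  proof (intro equalityI subsetI)
    fix \<sigma> assume "\<sigma> \<in> ?P"
    then show "\<sigma> \<in> ?L \<union> ?G" using distinct[of \<sigma>] by (simp add: neq_iff)
  qed auto
  have "finite ?P" by (simp add: finite_permutations)
  then have "finite ?L" "finite ?G" by (rule rev_finite_subset; blast)+
  then have "sum ?F ?P = sum ?F ?L + sum ?F ?G"
    unfolding split by (rule sum.union_disjoint) auto
  also have "sum ?F ?G = sum ?F ?L"
  proof (rule sum.reindex_bij_witness[of _ "\<lambda>\<sigma>. \<sigma> \<circ> ?t" "\<lambda>\<sigma>. \<sigma> \<circ> ?t"])
    fix \<sigma> assume \<sigma>: "\<sigma> \<in> ?L"
    then show "\<sigma> \<circ> ?t \<in> ?G" by (simp add: permutes_compose[OF t])
    show "\<sigma> \<circ> ?t \<circ> ?t = \<sigma>" by (simp add: o_assoc[symmetric])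
  next
    fix \<sigma> assume \<sigma>: "\<sigma> \<in> ?G"
    then show "\<sigma> \<circ> ?t \<in> ?L" by (simp add: permutes_compose[OF t])
    show "\<sigma> \<circ> ?t \<circ> ?t = \<sigma>" by (simp add: o_assoc[symmetric])
    show "?F (\<sigma> \<circ> ?t) = ?F \<sigma>" using \<sigma> by (intro swap) simp
  qed
  finally show ?thesis unfolding permanent_def by (simp add: mult_2[symmetric])
qed

text \<open>Multiplying out the product over the rows gives one summand for each map \<open>h\<close> of the index set
  into itself, namely a product of entries of \<open>f\<close> times the permanent of \<open>g\<close> with its rows taken
  along \<open>h\<close>. If \<open>h\<close> is not injective then that permanent has two equal rows.\<close>

lemma permanent_mult:
  fixes f g :: "nat \<Rightarrow> nat \<Rightarrow> 'a::comm_semiring_1"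
  shows "\<exists>x. permanent n (\<lambda>i j. \<Sum>k = 0..<n. f i k * g k j) = permanent n f * permanent n g + 2 * x"
proof -
  let ?N = "{0..<n}"
  let ?H = "PiE ?N (\<lambda>_. ?N)"
  let ?T = "\<lambda>h. (\<Prod>i = 0..<n. f i (h i)) * permanent n (\<lambda>i. g (h i))"
  have fin: "finite ?H" by (intro finite_PiE) auto
  have "permanent n (\<lambda>i j. \<Sum>k = 0..<n. f i k * g k j) =
      (\<Sum>\<sigma> | \<sigma> permutes ?N. \<Sum>h\<in>?H. \<Prod>i = 0..<n. f i (h i) * g (h i) (\<sigma> i))"
    unfolding permanent_def by (intro sum.cong refl prod_sum_PiE) auto
  also have "\<dots> = (\<Sum>h\<in>?H. \<Sum>\<sigma> | \<sigma> permutes ?N. \<Prod>i = 0..<n. f i (h i) * g (h i) (\<sigma> i))"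
    by (rule sum.swap)
  also have "\<dots> = (\<Sum>h\<in>?H. ?T h)"
    unfolding permanent_def by (simp add: prod.distrib sum_distrib_left)
  also have "\<dots> = (\<Sum>h\<in>{h\<in>?H. inj_on h ?N}. ?T h) + (\<Sum>h\<in>{h\<in>?H. \<not> inj_on h ?N}. ?T h)"
    using fin by (subst sum.union_disjoint[symmetric]) (auto intro!: sum.cong)
  also have "(\<Sum>h\<in>{h\<in>?H. inj_on h ?N}. ?T h) =
      (\<Sum>\<sigma> | \<sigma> permutes ?N. (\<Prod>i = 0..<n. f i (\<sigma> i)) * permanent n g)"
  proof (rule sum.reindex_bij_witness[of _ "\<lambda>\<sigma>. restrict \<sigma> ?N" "\<lambda>h x. if x \<in> ?N then h x else x"],
      goal_cases)
    case (1 h)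
    then show ?case by (auto simp: fun_eq_iff PiE_def extensional_def)
  next
    case (2 h)
    then have "inj_on (\<lambda>x. if x \<in> ?N then h x else x) ?N"
      by (auto simp: inj_on_def)
    with 2 show ?case by (intro CollectI inj_imp_permutes) auto
  next
    case (3 \<sigma>)
    then show ?case by (auto simp: fun_eq_iff permutes_not_in)
  next
    case (4 \<sigma>)
    then have "\<sigma> permutes ?N" by simp
    then show ?case
      using permutes_in_image[of \<sigma> ?N] permutes_inj_on[of \<sigma> ?N ?N] by (auto simp: inj_on_def)
  next
    case (5 h)
    let ?s = "\<lambda>x. if x \<in> ?N then h x else x"
    have "inj_on ?s ?N"
      using 5 by (auto simp: inj_on_def)
    with 5 have s: "?s permutes ?N" by (intro inj_imp_permutes) auto
    have "permanent n (\<lambda>i. g (h i)) = permanent n (\<lambda>i. g (?s i))"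
      by (rule permanent_cong) simp
    also have "\<dots> = permanent n g" by (rule permanent_permute_rows[OF s])
    finally show ?case by (intro arg_cong2[where f = "(*)"] prod.cong) auto
  qed
  also have "\<dots> = permanent n f * permanent n g"
    by (simp add: permanent_def sum_distrib_right)
  finally have "permanent n (\<lambda>i j. \<Sum>k = 0..<n. f i k * g k j) =
      permanent n f * permanent n g + (\<Sum>h\<in>{h\<in>?H. \<not> inj_on h ?N}. ?T h)" .
  moreover have "2 dvd (\<Sum>h\<in>{h\<in>?H. \<not> inj_on h ?N}. ?T h)"
  proof (rule dvd_sum)
    fix h assume "h \<in> {h\<in>?H. \<not> inj_on h ?N}"
    then obtain i k where "i < n" "k < n" "i \<noteq> k" "h i = h k" by (auto simp: inj_on_def)
    then have "2 dvd permanent n (\<lambda>i. g (h i))"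
      by (intro two_dvd_permanent_equal_rows[of i n k]) auto
    then show "2 dvd ?T h" by (rule dvd_mult)
  qed
  ultimately show ?thesis by (auto simp: dvd_def)
qed

text \<open>The sign-free Laplace expansion. The permutations are grouped by the value they take at \<open>i\<close>;
  those with \<open>\<sigma> i = j\<close> arise from the permutations of one index fewer by inserting \<open>i\<close> into the
  domain and \<open>j\<close> into the range.\<close>

lemma permanent_laplace_row:
  assumes i: "i < Suc m"
  shows "permanent (Suc m) f =
    (\<Sum>j = 0..<Suc m. f i j * permanent m (\<lambda>r c. f (insert_index i r) (insert_index j c)))"
proof -
  let ?N = "{0..<Suc m}"
  let ?F = "\<lambda>\<sigma>. \<Prod>r = 0..<Suc m. f r (\<sigma> r)"
  have "permanent (Suc m) f = (\<Sum>j\<in>?N. sum ?F {\<sigma> \<in> {\<sigma>. \<sigma> permutes ?N}. \<sigma> i = j})"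
    unfolding permanent_def
  proof (rule sum.group[symmetric])
    show "(\<lambda>\<sigma>. \<sigma> i) ` {\<sigma>. \<sigma> permutes ?N} \<subseteq> ?N"
      using i permutes_in_image[of _ ?N i] by auto
  qed (auto simp: finite_permutations)
  also have "\<dots> = (\<Sum>j\<in>?N. f i j * permanent m (\<lambda>r c. f (insert_index i r) (insert_index j c)))"
  proof (intro sum.cong refl)
    fix j assume "j \<in> ?N"
    then have j: "j < Suc m" by simp
    let ?Q = "{q. q permutes {0..<m}}"
    have F: "?F (permutation_insert i j q) =
        f i j * (\<Prod>r = 0..<m. f (insert_index i r) (insert_index j (q r)))" for q
    proof -
      let ?p = "permutation_insert i j q"
      have "?F ?p = f i (?p i) * (\<Prod>r\<in>?N - {i}. f r (?p r))"
        by (rule prod.remove) (use i in auto)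
      also have "?p i = j" by (rule permutation_insert_inserted)
      also have "(\<Prod>r\<in>?N - {i}. f r (?p r)) = (\<Prod>r = 0..<m. f (insert_index i r) (?p (insert_index i r)))"
        unfolding insert_index_image[OF i, symmetric]
        by (simp only: prod.reindex[OF insert_index_inj_on] o_def)
      also have "(\<lambda>r. ?p (insert_index i r)) = (\<lambda>r. insert_index j (q r))"
        by (rule ext) (simp add: permutation_insert_expand insert_index_def)
      finally show ?thesis .
    qed
    have "sum ?F {\<sigma> \<in> {\<sigma>. \<sigma> permutes ?N}. \<sigma> i = j} = sum ?F (permutation_insert i j ` ?Q)"
      by (simp only: permutation_fix[OF i j] mem_Collect_eq)
    also have "\<dots> = (\<Sum>q\<in>?Q. ?F (permutation_insert i j q))"
      by (simp only: sum.reindex[OF permutation_insert_inj_on[OF i j]] o_def)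
    finally show "sum ?F {\<sigma> \<in> {\<sigma>. \<sigma> permutes ?N}. \<sigma> i = j} =
        f i j * permanent m (\<lambda>r c. f (insert_index i r) (insert_index j c))"
      by (simp only: F permanent_def sum_distrib_left)
  qed
  finally show ?thesis .
qed

section \<open>Order and tangibility\<close>

lemma trop_mult_mono: "a \<le> b \<Longrightarrow> c \<le> d \<Longrightarrow> a * c \<le> b * (d::trop)"
  by (cases a; cases b; cases c; cases d) (auto simp: less_eq_trop_def)

lemma two_dvd_trop_iff: "2 dvd x \<longleftrightarrow> x \<in> ghost0"
proof
  assume "2 dvd x"
  then obtain y where "x = y + y" by (auto simp: mult_2 dvd_def)
  then show "x \<in> ghost0" by (cases y) (auto simp: ghost0_def)
next
  assume "x \<in> ghost0"
  then have "x = 2 * x" by (auto simp: ghost0_def mult_2)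
  then show "2 dvd x" by (rule dvdI)
qed

lemma ghost0_mult: "x \<in> ghost0 \<Longrightarrow> c * x \<in> ghost0"
  by (simp flip: two_dvd_trop_iff)

lemma trop_add_eq_Tang:
  assumes "x + y = Tang d"
  shows "x = Tang d \<and> y < Tang d \<or> y = Tang d \<and> x < Tang d"
  using assms by (cases x; cases y) (auto simp: max_def less_eq_trop_def split: if_splits)

lemma trop_add_less_Tang: "x < Tang d \<Longrightarrow> y < Tang d \<Longrightarrow> x + y < Tang d"
  by (cases x; cases y) (auto simp: max_def less_eq_trop_def split: if_splits)

lemma Tang_add_less: "y < Tang d \<Longrightarrow> Tang d + y = Tang d"
  by (cases y) (auto simp: max_def less_eq_trop_def)

lemma trop_sum_less_Tang:
  assumes "\<And>s. s \<in> S \<Longrightarrow> f s < Tang d"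
  shows "sum f S < Tang d"
  using assms by (induction S rule: infinite_finite_induct) (auto simp: zero_trop_def intro: trop_add_less_Tang)

text \<open>A tropical sum is real only if its maximum is attained once, by a real summand: a repeated
  maximum would turn it into a ghost. For determinants this yields the unique optimal permutation.\<close>

lemma trop_sum_eq_Tang_iff:
  assumes "finite S"
  shows "sum f S = Tang d \<longleftrightarrow> (\<exists>s\<in>S. f s = Tang d \<and> (\<forall>t\<in>S - {s}. f t < Tang d))"
proof
  show "\<exists>s\<in>S. f s = Tang d \<and> (\<forall>t\<in>S - {s}. f t < Tang d)" if "sum f S = Tang d"
    using assms that
  proof (induction S rule: finite_induct)
    case empty
    then show ?case by (simp add: zero_trop_def)
  next
    case (insert x S)
    from insert have "f x + sum f S = Tang d" by simp
    then consider "f x = Tang d" "sum f S < Tang d" | "sum f S = Tang d" "f x < Tang d"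
      using trop_add_eq_Tang by blast
    then show ?case
    proof cases
      case 1
      have "f t < Tang d" if "t \<in> S" for t
      proof -
        have "f t \<le> f t + y" for y
          by (cases "f t"; cases y) (auto simp: less_eq_trop_def max_def)
        then have "f t \<le> sum f S" using insert.hyps(1) that by (simp add: sum.remove)
        then show ?thesis using 1 by simp
      qed
      then show ?thesis using 1 insert.hyps by auto
    next
      case 2
      then show ?thesis using insert by auto
    qed
  qed
next
  assume "\<exists>s\<in>S. f s = Tang d \<and> (\<forall>t\<in>S - {s}. f t < Tang d)"
  then obtain s where s: "s \<in> S" "f s = Tang d" "\<forall>t\<in>S - {s}. f t < Tang d" by blast
  then have "sum f (S - {s}) < Tang d" by (intro trop_sum_less_Tang) auto
  then show "sum f S = Tang d"
    using s assms by (simp add: sum.remove Tang_add_less)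
qed

lemma trop_mult_eq_TangD: "x * y = Tang d \<Longrightarrow> x \<in> range Tang \<and> y \<in> range Tang"
  by (cases x; cases y) auto

lemma trop_prod_eq_TangD:
  assumes "finite S" "prod f S = Tang d" "s \<in> S"
  shows "f s \<in> range Tang"
  using assms trop_mult_eq_TangD[of "f s" "prod f (S - {s})" d] by (simp add: prod.remove)

lemma prod_Tang: "(\<Prod>s\<in>S. Tang (c s)) = Tang (sum c S)"
  by (induction S rule: infinite_finite_induct) (auto simp: one_trop_def)

lemma Tang_power: "Tang e ^ k = Tang (real k * e)"
  by (induction k) (auto simp: one_trop_def algebra_simps)

text \<open>The weight of \<open>x\<close>, forgetting whether it is a ghost, is at most \<open>c\<close> if and only if \<open>x \<le> Ghost c\<close>,
  and it is less than \<open>c\<close> if and only if \<open>x < Tang c\<close>. The next two lemmas add up such bounds.\<close>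

lemma trop_prod_le_Ghost:
  assumes "\<And>s. s \<in> S \<Longrightarrow> f s \<le> Ghost (c s)"
  shows "prod f S \<le> Ghost (sum c S)"
  using assms
proof (induction S rule: infinite_finite_induct)
  case (insert x S)
  then have "f x * prod f S \<le> Ghost (c x) * Ghost (sum c S)" by (intro trop_mult_mono) auto
  with insert show ?case by simp
qed (auto simp: one_trop_def less_eq_trop_def)

lemma trop_prod_less_Tang:
  assumes "finite S" "\<And>s. s \<in> S \<Longrightarrow> f s \<le> Ghost (c s)" "s \<in> S" "f s < Tang (c s)"
  shows "prod f S < Tang (sum c S)"
proof -
  have "prod f (S - {s}) \<le> Ghost (sum c (S - {s}))" by (rule trop_prod_le_Ghost) (use assms in auto)
  moreover have "x * y < Tang (a + b)" if "x < Tang a" "y \<le> Ghost b" for x y a b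
    using that by (cases x; cases y) (auto simp: less_eq_trop_def)
  ultimately have "f s * prod f (S - {s}) < Tang (c s + sum c (S - {s}))" using assms by blast
  then show ?thesis using assms by (simp add: prod.remove sum.remove)
qed


section \<open>Potentials from strictly negative cycles\<close>

text \<open>The list is read as a walk, and \<open>b\<close> as the matrix of arc weights of a complete digraph. Since
  \<open>map2\<close> stops at the shorter list, every consecutive pair contributes one factor.\<close>

definition path_weight :: "(nat \<Rightarrow> nat \<Rightarrow> trop) \<Rightarrow> nat list \<Rightarrow> trop" where
  "path_weight b vs = prod_list (map2 b vs (tl vs))"

lemma path_weight_simps [simp]:
  "path_weight b [i] = 1"
  "path_weight b (i # j # vs) = b i j * path_weight b (j # vs)"
  by (simp_all add: path_weight_def)

text \<open>This splits a walk at a vertex; it is used to cut a cycle off a walk that returns to its start.\<close>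

lemma path_weight_append:
  "path_weight b (us @ v # ws) = path_weight b (us @ [v]) * path_weight b (v # ws)"
  by (induction us rule: induct_list012) (auto simp: mult.assoc)

lemma path_weight_scale:
  "path_weight (\<lambda>i j. b i j * c) (v # vs) = path_weight b (v # vs) * c ^ length vs"
  by (induction vs arbitrary: v) (auto simp: ac_simps)

text \<open>A simple cycle has the weight of the cyclic permutation on its vertices, which turns hypotheses
  on permutations into hypotheses on cycles.\<close>

lemma path_weight_closed:
  assumes "distinct (i # vs)"
  shows "path_weight b (i # vs @ [i]) =
    (\<Prod>v\<in>set (i # vs). b v (cycle_of_list (i # vs) v))"
proof -
  let ?\<sigma> = "cycle_of_list (i # vs)"
  have "map ?\<sigma> (i # vs) = vs @ [i]" using cyclic_rotation[OF assms, of 1] by simp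
  then have "path_weight b (i # vs @ [i]) = prod_list (map2 b ((i # vs) @ [i]) (map ?\<sigma> (i # vs)))"
    by (simp add: path_weight_def)
  also have "\<dots> = prod_list (map2 b (i # vs) (map ?\<sigma> (i # vs)))"
    by (subst zip_append1) simp
  also have "\<dots> = prod_list (map (\<lambda>v. b v (?\<sigma> v)) (i # vs))"
    by (simp only: zip_map2 map_map zip_same_conv_map o_def) simp
  also have "\<dots> = (\<Prod>v\<in>set (i # vs). b v (?\<sigma> v))"
    using assms by (subst prod.distinct_set_conv_list) auto
  finally show ?thesis .
qed

text \<open>The potential of \<open>i\<close> is the maximal weight of a simple path that starts at \<open>i\<close> and ends anywhere.
  The one-vertex path makes it at least \<open>1\<close>, hence not \<open>-\<infinity>\<close>, even if some arcs are missing. An arc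
  followed by an optimal path is again a simple path, unless the path returns to \<open>i\<close>; in that case
  the cycle so formed has weight at most \<open>1\<close> and may be dropped.\<close>

lemma path_potential:
  assumes "finite V"
    and cycle: "\<And>i j vs. distinct (i # j # vs) \<Longrightarrow> set (i # j # vs) \<subseteq> V \<Longrightarrow>
      path_weight b (i # j # vs @ [i]) \<le> 1"
  obtains P where "\<And>i. i \<in> V \<Longrightarrow> 1 \<le> P i"
    and "\<And>i j. i \<in> V \<Longrightarrow> j \<in> V \<Longrightarrow> i \<noteq> j \<Longrightarrow> b i j * P j \<le> P i"
proof -
  define D where "D i = {vs. distinct (i # vs) \<and> set (i # vs) \<subseteq> V}" for i
  define P where "P i = Max ((\<lambda>vs. path_weight b (i # vs)) ` D i)" for i
  have fin: "finite (D i)" for i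
    by (rule finite_subset[OF _ finite_subset_distinct[OF \<open>finite V\<close>]]) (auto simp: D_def)
  have nonempty: "[] \<in> D i" if "i \<in> V" for i using that by (simp add: D_def)
  have upper: "path_weight b (i # vs) \<le> P i" if "vs \<in> D i" for i vs
    unfolding P_def using fin that by (intro Max_ge) auto
  have "b i j * P j \<le> P i" if ij: "i \<in> V" "j \<in> V" "i \<noteq> j" for i j
  proof -
    have "P j \<in> (\<lambda>vs. path_weight b (j # vs)) ` D j"
      unfolding P_def using fin nonempty[OF ij(2)] by (intro Max_in) auto
    then obtain vs where vs: "vs \<in> D j" and "P j = path_weight b (j # vs)" by blast
    then have P: "b i j * P j = path_weight b (i # j # vs)" by simp
    show ?thesis
    proof (cases "i \<in> set vs")
      case False
      then have "j # vs \<in> D i" using vs ij by (auto simp: D_def)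
      then show ?thesis unfolding P by (rule upper)
    next
      case True
      then obtain ys zs where split: "vs = ys @ i # zs" by (meson split_list)
      then have "path_weight b (i # j # vs) = path_weight b (i # j # ys @ [i]) * path_weight b (i # zs)"
        using path_weight_append[of b "i # j # ys" i zs] by simp
      also have "\<dots> \<le> 1 * P i"
        using vs ij unfolding split
        by (intro trop_mult_mono cycle upper) (auto simp: D_def)
      finally show ?thesis unfolding P by simp
    qed
  qed
  moreover have "1 \<le> P i" if "i \<in> V" for i
    using upper[OF nonempty[OF that]] by simp
  ultimately show thesis using that by blast
qed

text \<open>To get strict inequalities, raise every arc by a small \<open>e > 0\<close>. There are finitely many simple
  cycles of length at least two and all have negative weight, so for small \<open>e\<close> none of them becomes
  positive. The raised arcs then admit a potential, and it is strict for the original arcs.\<close>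

lemma strict_potential:
  assumes diag: "\<And>i. i < n \<Longrightarrow> b i i = 1"
    and less: "\<And>\<sigma>. \<sigma> permutes {0..<n} \<Longrightarrow> \<sigma> \<noteq> id \<Longrightarrow> (\<Prod>i = 0..<n. b i (\<sigma> i)) < 1"
  obtains p :: "nat \<Rightarrow> real"
    where "\<And>i j. i < n \<Longrightarrow> j < n \<Longrightarrow> i \<noteq> j \<Longrightarrow> b i j < Tang (p i - p j)"
proof -
  let ?V = "{0..<n}"
  define C where "C = {vs. set vs \<subseteq> ?V \<and> distinct vs \<and> 2 \<le> length vs}"
  have "finite C"
    by (rule finite_subset[OF _ finite_subset_distinct[of ?V]]) (auto simp: C_def)
  have cycle_less: "path_weight b (vs @ [hd vs]) < 1" if "vs \<in> C" for vs
  proof -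
    from that obtain i j ws where vs: "vs = i # j # ws"
      by (cases vs; cases "tl vs") (auto simp: C_def)
    let ?\<sigma> = "cycle_of_list vs"
    have dist: "distinct vs" and sub: "set vs \<subseteq> ?V" using that by (auto simp: C_def)
    have "?\<sigma> i = j" using cyclic_rotation[OF dist, of 1] vs by simp
    moreover have "i \<noteq> j" using dist vs by simp
    ultimately have ne: "?\<sigma> \<noteq> id" by (metis id_apply)
    have "path_weight b (vs @ [hd vs]) = (\<Prod>v\<in>set vs. b v (?\<sigma> v))"
      using path_weight_closed[of i "j # ws" b] dist vs by simp
    also have "\<dots> = (\<Prod>v\<in>?V. b v (?\<sigma> v))"
      using sub diag id_outside_supp[of _ vs]
      by (intro prod.mono_neutral_left) auto
    also have "\<dots> < 1"
      using permutes_subset[OF cycle_permutes sub] ne by (rule less)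
    finally show ?thesis .
  qed
  have "\<forall>vs\<in>C. eventually (\<lambda>e. path_weight b (vs @ [hd vs]) * Tang e ^ length vs \<le> 1) (at_right 0)"
  proof
    fix vs assume vs: "vs \<in> C"
    then have len: "real (length vs) > 0" by (auto simp: C_def)
    define x where "x = path_weight b (vs @ [hd vs])"
    define a where "a = (case x of Tang a \<Rightarrow> a | Ghost a \<Rightarrow> a | MInf \<Rightarrow> -1)"
    have "x < 1" unfolding x_def by (rule cycle_less[OF vs])
    then have "a < 0" by (cases x) (auto simp: a_def one_trop_def)
    have "x * Tang e ^ length vs \<le> 1" if "0 < e" "e < - a / length vs" for e
    proof -
      have "length vs * e < - a" using that(2) len by (simp add: field_simps)
      then show ?thesis using \<open>x < 1\<close>
        by (cases x) (auto simp: a_def Tang_power one_trop_def less_eq_trop_def)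
    qed
    moreover have "0 < - a / length vs" using \<open>a < 0\<close> len by (intro divide_pos_pos) simp_all
    ultimately show "eventually (\<lambda>e. path_weight b (vs @ [hd vs]) * Tang e ^ length vs \<le> 1) (at_right 0)"
      unfolding eventually_at_right_field x_def by blast
  qed
  from eventually_ball_finite[OF \<open>finite C\<close> this]
  have "eventually (\<lambda>e. e > 0 \<and> (\<forall>vs\<in>C. path_weight b (vs @ [hd vs]) * Tang e ^ length vs \<le> 1)) (at_right 0)"
    using eventually_at_right_less by (rule eventually_conj[rotated])
  then obtain e :: real where e: "e > 0"
    "\<And>vs. vs \<in> C \<Longrightarrow> path_weight b (vs @ [hd vs]) * Tang e ^ length vs \<le> 1"
    using eventually_happens' trivial_limit_at_right_real by (metis (no_types, lifting))
  let ?b = "\<lambda>i j. b i j * Tang e"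
  obtain P where P: "\<And>i. i \<in> ?V \<Longrightarrow> 1 \<le> P i"
    and step: "\<And>i j. i \<in> ?V \<Longrightarrow> j \<in> ?V \<Longrightarrow> i \<noteq> j \<Longrightarrow> ?b i j * P j \<le> P i"
  proof (rule path_potential[of ?V ?b])
    fix i j vs assume "distinct (i # j # vs)" "set (i # j # vs) \<subseteq> ?V"
    then have "path_weight b ((i # j # vs) @ [hd (i # j # vs)]) * Tang e ^ length (i # j # vs) \<le> 1"
      by (intro e) (simp add: C_def)
    then show "path_weight ?b (i # j # vs @ [i]) \<le> 1"
      using path_weight_scale[of b "Tang e" i "j # vs @ [i]"] by simp
  qed auto
  define p where "p i = (case P i of Tang a \<Rightarrow> a | Ghost a \<Rightarrow> a | MInf \<Rightarrow> 0)" for i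
  have "b i j < Tang (p i - p j)" if "i < n" "j < n" "i \<noteq> j" for i j
  proof -
    have "?b i j * P j \<le> P i" "1 \<le> P i" "1 \<le> P j" using that P step by auto
    then show ?thesis
      using \<open>e > 0\<close> by (cases "b i j"; cases "P i"; cases "P j")
        (auto simp: p_def one_trop_def less_eq_trop_def)
  qed
  then show thesis by (rule that)
qed

text \<open>Permuting the columns along the optimal permutation and dividing each column by its optimal entry
  puts \<open>1\<close> on the diagonal and makes every other permutation strictly negative. A strict
  potential \<open>p\<close> of this normalised matrix gives \<open>u = p\<close>, and \<open>v\<close> is obtained by undoing the
  normalisation.\<close>

lemma assignment_potentials:
  assumes "permanent n f = Tang d"
  obtains \<pi> and u v :: "nat \<Rightarrow> real" where "\<pi> permutes {0..<n}"
    and "sum u {0..<n} + sum v {0..<n} = d"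
    and "\<And>i. i < n \<Longrightarrow> f i (\<pi> i) = Tang (u i + v (\<pi> i))"
    and "\<And>i j. i < n \<Longrightarrow> j < n \<Longrightarrow> j \<noteq> \<pi> i \<Longrightarrow> f i j < Tang (u i + v j)"
proof -
  let ?V = "{0..<n}"
  have "finite {\<sigma>. \<sigma> permutes ?V}" by (simp add: finite_permutations)
  from assms[unfolded permanent_def trop_sum_eq_Tang_iff[OF this]]
  obtain \<pi> where \<pi>: "\<pi> permutes ?V" "(\<Prod>i\<in>?V. f i (\<pi> i)) = Tang d"
    and less: "\<And>\<sigma>. \<sigma> permutes ?V \<Longrightarrow> \<sigma> \<noteq> \<pi> \<Longrightarrow> (\<Prod>i\<in>?V. f i (\<sigma> i)) < Tang d"
    by auto
  define w where "w i = tang_val (f i (\<pi> i))" for i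
  have w: "f i (\<pi> i) = Tang (w i)" if "i < n" for i
    using trop_prod_eq_TangD[OF _ \<pi>(2), of i] that by (auto simp: w_def)
  have "Tang (sum w ?V) = Tang d"
    unfolding \<pi>(2)[symmetric] prod_Tang[symmetric] by (intro prod.cong) (auto simp: w)
  then have sum_w: "sum w ?V = d" by simp
  define b where "b i j = f i (\<pi> j) * Tang (- w j)" for i j
  obtain p where p: "\<And>i j. i < n \<Longrightarrow> j < n \<Longrightarrow> i \<noteq> j \<Longrightarrow> b i j < Tang (p i - p j)"
  proof (rule strict_potential[of n b])
    show "b i i = 1" if "i < n" for i using that by (simp add: b_def w one_trop_def)
    fix \<sigma> assume \<sigma>: "\<sigma> permutes ?V" "\<sigma> \<noteq> id"
    have "\<pi> \<circ> \<sigma> \<noteq> \<pi>"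
      using \<sigma>(2) permutes_inj[OF \<pi>(1)] by (auto simp: fun_eq_iff inj_eq)
    with permutes_compose[OF \<sigma>(1) \<pi>(1)] have "(\<Prod>i\<in>?V. f i ((\<pi> \<circ> \<sigma>) i)) < Tang d"
      by (rule less)
    moreover have "sum (\<lambda>i. - w (\<sigma> i)) ?V = - d"
      using sum.permute[OF \<sigma>(1), of w] sum_w by (simp add: sum_negf o_def)
    then have "(\<Prod>i\<in>?V. b i (\<sigma> i)) = (\<Prod>i\<in>?V. f i ((\<pi> \<circ> \<sigma>) i)) * Tang (- d)"
      by (simp add: b_def prod.distrib prod_Tang)
    moreover have "x * Tang (- d) < 1" if "x < Tang d" for x
      using that by (cases x) (auto simp: one_trop_def)
    ultimately show "(\<Prod>i\<in>?V. b i (\<sigma> i)) < 1" by simp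
  qed blast
  define v where "v j = w (inv_into UNIV \<pi> j) - p (inv_into UNIV \<pi> j)" for j
  have v: "v (\<pi> j) = w j - p j" for j
    by (simp add: v_def permutes_inverses[OF \<pi>(1)])
  show thesis
  proof (rule that[of \<pi> p v])
    have "sum v ?V = sum w ?V - sum p ?V"
      using sum.permute[OF \<pi>(1), of v] by (simp add: o_def v sum_subtractf)
    then show "sum p ?V + sum v ?V = d" by (simp add: sum_w)
    show "f i (\<pi> i) = Tang (p i + v (\<pi> i))" if "i < n" for i
      using that by (simp add: w v)
    fix i j assume ij: "i < n" "j < n" "j \<noteq> \<pi> i"
    \<comment> \<open>the row whose optimal entry lies in column \<open>j\<close>\<close>
    define j' where "j' = inv_into UNIV \<pi> j"
    have j: "j = \<pi> j'" by (simp add: j'_def permutes_inverses[OF \<pi>(1)])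
    have "j' < n" using permutes_in_image[OF \<pi>(1), of j'] ij j by simp
    moreover have "i \<noteq> j'" using ij j by auto
    ultimately have "b i j' < Tang (p i - p j')" using ij by (intro p)
    then show "f i j < Tang (p i + v j)"
      unfolding b_def j v by (cases "f i (\<pi> j')") auto
  qed (rule \<pi>)
qed

text \<open>The matrix with row \<open>k\<close> replaced by row \<open>i\<close> still obeys the bounds given by the potentials, with
  \<open>u k\<close> changed to \<open>u i\<close>. The bound is tight in row \<open>r\<close> only at the column \<open>\<pi> r\<close>, and at \<open>\<pi> i\<close> for
  both rows \<open>i\<close> and \<open>k\<close>; a permutation cannot use that column twice, so it loses strictly in
  some row.\<close>

lemma replaced_row_permanent_less:
  fixes u v :: "nat \<Rightarrow> real"
  assumes \<pi>: "sum u {0..<n} + sum v {0..<n} = d"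
      "\<And>i. i < n \<Longrightarrow> f i (\<pi> i) = Tang (u i + v (\<pi> i))"
      "\<And>i j. i < n \<Longrightarrow> j < n \<Longrightarrow> j \<noteq> \<pi> i \<Longrightarrow> f i j < Tang (u i + v j)"
    and ik: "i < n" "k < n" "i \<noteq> k"
  shows "permanent n (f(k := f i)) < Tang (d + u i - u k)"
  unfolding permanent_def
proof (rule trop_sum_less_Tang)
  let ?V = "{0..<n}" and ?u = "u(k := u i)" and ?\<pi> = "\<pi>(k := \<pi> i)"
  fix \<sigma> assume "\<sigma> \<in> {\<sigma>. \<sigma> permutes ?V}"
  then have \<sigma>: "\<sigma> permutes ?V" by simp
  have row: "(f(k := f i)) r (\<sigma> r) \<le> Ghost (?u r + v (\<sigma> r))"
      "\<sigma> r \<noteq> ?\<pi> r \<Longrightarrow> (f(k := f i)) r (\<sigma> r) < Tang (?u r + v (\<sigma> r))" if "r < n" for r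
  proof -
    \<comment> \<open>the row of \<open>f\<close> that now stands in row \<open>r\<close>\<close>
    define r' where "r' = (if r = k then i else r)"
    have r': "r' < n" "(f(k := f i)) r = f r'" "?u r = u r'" "?\<pi> r = \<pi> r'"
      using that ik by (auto simp: r'_def)
    have \<sigma>r: "\<sigma> r < n" using permutes_in_image[OF \<sigma>, of r] that by simp
    have "Tang x \<le> Ghost x" "y < Tang x \<Longrightarrow> y \<le> Ghost x" for x y
      by (cases y; auto simp: less_eq_trop_def)+
    then show "(f(k := f i)) r (\<sigma> r) \<le> Ghost (?u r + v (\<sigma> r))"
      unfolding r' using \<pi>(2)[OF r'(1)] \<pi>(3)[OF r'(1) \<sigma>r] by (cases "\<sigma> r = \<pi> r'") auto
    show "(f(k := f i)) r (\<sigma> r) < Tang (?u r + v (\<sigma> r))" if "\<sigma> r \<noteq> ?\<pi> r"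
      using that unfolding r' by (intro \<pi>(3) r'(1) \<sigma>r)
  qed
  have "\<exists>r<n. \<sigma> r \<noteq> ?\<pi> r"
  proof (rule ccontr)
    assume "\<not> ?thesis"
    then have "\<sigma> i = \<sigma> k" using ik by auto
    then show False using permutes_inj[OF \<sigma>] ik by (simp add: inj_eq)
  qed
  then obtain r where "r < n" "\<sigma> r \<noteq> ?\<pi> r" by blast
  then have "(\<Prod>r\<in>?V. (f(k := f i)) r (\<sigma> r)) < Tang (\<Sum>r\<in>?V. ?u r + v (\<sigma> r))"
    using row by (intro trop_prod_less_Tang[of _ _ _ r]) auto
  also have "(\<Sum>r\<in>?V. ?u r + v (\<sigma> r)) = sum ?u ?V + sum v ?V"
    using sum.permute[OF \<sigma>, of v] by (simp add: sum.distrib o_def)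
  also have "sum ?u ?V = sum u ?V + u i - u k"
  proof -
    have "sum ?u (?V - {k}) = sum u (?V - {k})" by (rule sum.cong) auto
    then show ?thesis using ik by (simp add: sum.remove[of ?V k])
  qed
  finally show "(\<Prod>r\<in>?V. (f(k := f i)) r (\<sigma> r)) < Tang (d + u i - u k)"
    using \<pi>(1) by (simp add: algebra_simps)
qed

section \<open>Adjoints and pseudo inverses\<close>

lemma trop_det_permanent:
  "A \<in> carrier_mat n n \<Longrightarrow> trop_det A = permanent n (\<lambda>i j. A $$ (i, j))"
  by (simp add: trop_det_def permanent_def)

lemma trop_det_mult:
  assumes A: "A \<in> carrier_mat n n" and B: "B \<in> carrier_mat n n"
  shows "\<exists>x. trop_det (A * B) = trop_det A * trop_det B + 2 * x"
proof -
  have "trop_det (A * B) = permanent n (\<lambda>i j. \<Sum>k = 0..<n. A $$ (i, k) * B $$ (k, j))"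
    unfolding trop_det_permanent[OF mult_carrier_mat[OF A B]]
    by (rule permanent_cong) (use A B in \<open>auto simp: scalar_prod_def\<close>)
  then show ?thesis
    using permanent_mult[of n "\<lambda>i j. A $$ (i, j)" "\<lambda>i j. B $$ (i, j)"]
    by (simp only: trop_det_permanent[OF A] trop_det_permanent[OF B])
qed

lemma trop_adj_carrier: "A \<in> carrier_mat n n \<Longrightarrow> trop_adj A \<in> carrier_mat n n"
  by (simp add: trop_adj_def)

text \<open>The minors of row \<open>k\<close> do not see row \<open>k\<close>, so the sum defining the entry is the Laplace expansion
  along row \<open>k\<close> of the matrix in which that row has been overwritten by row \<open>i\<close>.\<close>

lemma mult_trop_adj_index:
  assumes A: "A \<in> carrier_mat n n" and ik: "i < n" "k < n"
  shows "(A * trop_adj A) $$ (i, k) =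
    permanent n ((\<lambda>r c. A $$ (r, c))(k := \<lambda>c. A $$ (i, c)))"
proof -
  let ?F = "(\<lambda>r c. A $$ (r, c))(k := \<lambda>c. A $$ (i, c))"
  obtain m where n: "n = Suc m" using ik by (cases n) auto
  have minor: "trop_det (mat_delete A k j) =
      permanent m (\<lambda>r c. ?F (insert_index k r) (insert_index j c))" if "j < n" for j
  proof -
    have "mat_delete A k j \<in> carrier_mat m m" using mat_delete_carrier[OF A] n by simp
    then have "trop_det (mat_delete A k j) = permanent m (\<lambda>r c. mat_delete A k j $$ (r, c))"
      by (rule trop_det_permanent)
    also have "\<dots> = permanent m (\<lambda>r c. ?F (insert_index k r) (insert_index j c))"
    proof (rule permanent_cong)
      fix r c assume "r < m" "c < m"
      then have "mat_delete A k j $$ (r, c) = A $$ (insert_index k r, insert_index j c)"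
        using A ik that n by (intro mat_delete_index[symmetric]) auto
      then show "mat_delete A k j $$ (r, c) = ?F (insert_index k r) (insert_index j c)"
        by simp
    qed
    finally show ?thesis .
  qed
  have "(A * trop_adj A) $$ (i, k) = (\<Sum>j = 0..<n. A $$ (i, j) * trop_det (mat_delete A k j))"
    using A ik by (auto simp: scalar_prod_def trop_adj_def intro!: sum.cong)
  also have "\<dots> = (\<Sum>j = 0..<n. ?F k j * permanent m (\<lambda>r c. ?F (insert_index k r) (insert_index j c)))"
    by (intro sum.cong refl) (simp only: minor atLeastLessThan_iff fun_upd_same)
  also have "\<dots> = permanent n ?F"
    using permanent_laplace_row[of k m ?F] ik n by simp
  finally show ?thesis .
qed

text \<open>Regularity is the substantial condition. An off-diagonal entry \<open>(i, k)\<close> lies below \<open>u i - u k\<close>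
  and these bounds add up to \<open>0\<close> along any permutation. A permutation other than the identity uses an
  off-diagonal entry and so falls strictly below \<open>0\<close>, the term of the identity.\<close>

lemma mult_trop_adj_div_det_pseudo_unit:
  assumes A: "A \<in> carrier_mat n n" and reg: "trop_regular A"
  shows "A * trop_adj_div_det A \<in> pseudo_units n"
proof -
  let ?f = "\<lambda>i j. A $$ (i, j)" and ?V = "{0..<n}"
  let ?U = "A * trop_adj_div_det A"
  obtain d where d: "trop_det A = Tang d" using reg by (auto simp: trop_regular_iff)
  then have perm: "permanent n ?f = Tang d" by (simp add: trop_det_permanent[OF A])
  from assignment_potentials[OF perm] obtain \<pi> and u v :: "nat \<Rightarrow> real" where
    \<pi>: "sum u ?V + sum v ?V = d"
      "\<And>i. i < n \<Longrightarrow> ?f i (\<pi> i) = Tang (u i + v (\<pi> i))"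
      "\<And>i j. i < n \<Longrightarrow> j < n \<Longrightarrow> j \<noteq> \<pi> i \<Longrightarrow> ?f i j < Tang (u i + v j)"
    by metis
  have "?U = Tang (- d) \<cdot>\<^sub>m (A * trop_adj A)"
    unfolding trop_adj_div_det_def d using mult_smult_distrib[OF A trop_adj_carrier[OF A]] by simp
  then have U: "?U $$ (i, k) = Tang (- d) * permanent n (?f(k := ?f i))" if "i < n" "k < n" for i k
    using A that mult_trop_adj_index[OF A that] trop_adj_carrier[OF A] by simp
  have carrier: "?U \<in> carrier_mat n n"
    using A trop_adj_carrier[OF A] by (simp add: trop_adj_div_det_def)
  have diag: "?U $$ (i, i) = Tang 0" if "i < n" for i
    using that by (simp add: U fun_upd_idem perm)
  have ghost: "?U $$ (i, k) \<in> ghost0" if "i < n" "k < n" "i \<noteq> k" for i k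
  proof -
    have "2 dvd permanent n (?f(k := ?f i))"
      by (rule two_dvd_permanent_equal_rows[of i n k]) (use that in auto)
    then show ?thesis using that by (simp add: U ghost0_mult two_dvd_trop_iff)
  qed
  have less: "?U $$ (i, k) < Tang (u i - u k)" if "i < n" "k < n" "i \<noteq> k" for i k
  proof -
    have "permanent n (?f(k := ?f i)) < Tang (d + u i - u k)"
      using \<pi> that by (rule replaced_row_permanent_less)
    moreover have "Tang (- d) * x < Tang (u i - u k)" if "x < Tang (d + u i - u k)" for x
      using that by (cases x) auto
    ultimately show ?thesis using that by (simp add: U)
  qed
  have "permanent n (\<lambda>i k. ?U $$ (i, k)) = Tang 0"
    unfolding permanent_def
  proof (subst trop_sum_eq_Tang_iff, goal_cases)
    case 1
    show ?case by (simp add: finite_permutations)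
  next
    case 2
    show ?case
    proof (intro bexI[of _ id] conjI ballI)
      show "(\<Prod>i\<in>?V. ?U $$ (i, id i)) = Tang 0"
        by (simp add: diag Tang_power)
      fix \<sigma> assume "\<sigma> \<in> {\<sigma>. \<sigma> permutes ?V} - {id}"
      then have \<sigma>: "\<sigma> permutes ?V" "\<sigma> \<noteq> id" by auto
      then obtain s where s: "\<sigma> s \<noteq> s" by (auto simp: fun_eq_iff)
      then have "s \<in> ?V" using permutes_not_in[OF \<sigma>(1)] by blast
      have \<sigma>n: "\<sigma> i < n" if "i < n" for i using permutes_in_image[OF \<sigma>(1), of i] that by simp
      have "(\<Prod>i\<in>?V. ?U $$ (i, \<sigma> i)) < Tang (\<Sum>i\<in>?V. u i - u (\<sigma> i))"
      proof (rule trop_prod_less_Tang[OF _ _ \<open>s \<in> ?V\<close>])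
        show "?U $$ (s, \<sigma> s) < Tang (u s - u (\<sigma> s))" using s \<open>s \<in> ?V\<close> \<sigma>n by (intro less) auto
        fix i assume i: "i \<in> ?V"
        have *: "y < Tang x \<Longrightarrow> y \<le> Ghost x" for x y
          by (cases y; auto simp: less_eq_trop_def)
        show "?U $$ (i, \<sigma> i) \<le> Ghost (u i - u (\<sigma> i))"
        proof (cases "\<sigma> i = i")
          case True
          then show ?thesis using i by (simp add: diag less_eq_trop_def)
        next
          case False
          then show ?thesis using i \<sigma>n by (intro * less) auto
        qed
      qed simp
      also have "(\<Sum>i\<in>?V. u i - u (\<sigma> i)) = 0"
        using sum.permute[OF \<sigma>(1), of u] by (simp add: sum_subtractf o_def)
      finally show "(\<Prod>i\<in>?V. ?U $$ (i, \<sigma> i)) < Tang 0" .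
    qed simp
  qed
  then have "trop_regular ?U"
    by (simp add: trop_regular_iff trop_det_permanent[OF carrier])
  then show ?thesis using carrier diag ghost by (auto simp: pseudo_units_def)
qed

lemma trop_det_transpose: "A \<in> carrier_mat n n \<Longrightarrow> trop_det A\<^sup>T = trop_det A"
  unfolding trop_det_permanent[of A n] trop_det_permanent[of "A\<^sup>T" n, OF transpose_carrier_mat[THEN iffD2]]
  by (subst permanent_transpose[symmetric]) (auto intro: permanent_cong)

lemma trop_regular_transpose: "A \<in> carrier_mat n n \<Longrightarrow> trop_regular A\<^sup>T \<longleftrightarrow> trop_regular A"
  by (simp add: trop_regular_iff trop_det_transpose)

lemma trop_adj_div_det_transpose:
  assumes A: "A \<in> carrier_mat n n"
  shows "trop_adj_div_det A\<^sup>T = (trop_adj_div_det A)\<^sup>T"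
proof -
  have "trop_det (mat_delete A\<^sup>T i j) = trop_det (mat_delete A j i)" if "i < n" "j < n" for i j
  proof -
    have "mat_delete A\<^sup>T i j = (mat_delete A j i)\<^sup>T"
      using A by (auto simp: mat_delete_def)
    then show ?thesis using trop_det_transpose[OF mat_delete_carrier[OF A]] by simp
  qed
  then show ?thesis
    using A by (auto simp: trop_adj_div_det_def trop_adj_def trop_det_transpose[OF A])
qed

lemma pseudo_units_transpose:
  assumes "U\<^sup>T \<in> pseudo_units n"
  shows "U \<in> pseudo_units n"
  using assms trop_regular_transpose[of U n] by (auto simp: pseudo_units_def)

lemma pseudo_inverse_trop_adj_div_det:
  assumes A: "A \<in> carrier_mat n n" and reg: "trop_regular A"
  shows "pseudo_inverse n A (trop_adj_div_det A)"
proof -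
  have B: "trop_adj_div_det A \<in> carrier_mat n n"
    using trop_adj_carrier[OF A] by (simp add: trop_adj_div_det_def)
  have "A\<^sup>T * trop_adj_div_det A\<^sup>T \<in> pseudo_units n"
    using A reg by (intro mult_trop_adj_div_det_pseudo_unit) (simp_all add: trop_regular_transpose[OF A])
  then have "(trop_adj_div_det A * A)\<^sup>T \<in> pseudo_units n"
    by (simp only: transpose_mult[OF B A] trop_adj_div_det_transpose[OF A])
  then show ?thesis
    using mult_trop_adj_div_det_pseudo_unit[OF A reg] B
    by (auto simp: pseudo_inverse_def intro: pseudo_units_transpose)
qed

text \<open>A real determinant of \<open>A * B\<close> cannot come from the ghost remainder in the product
  formula, so it equals \<open>trop_det A * trop_det B\<close>; and a product is real only if both factors
  are.\<close>

lemma trop_regular_factor: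
  assumes A: "A \<in> carrier_mat n n" and B: "B \<in> carrier_mat n n"
    and reg: "trop_regular (A * B)"
  shows "trop_regular A"
proof -
  obtain d where d: "trop_det (A * B) = Tang d" using reg by (auto simp: trop_regular_iff)
  obtain x where "trop_det (A * B) = trop_det A * trop_det B + 2 * x"
    using trop_det_mult[OF A B] by blast
  then have "trop_det A * trop_det B = Tang d \<or> 2 * x = Tang d"
    using trop_add_eq_Tang d by metis
  moreover have "2 * x \<in> ghost0" by (simp flip: two_dvd_trop_iff)
  ultimately have "trop_det A * trop_det B = Tang d" by (auto simp: ghost0_def)
  then show ?thesis using trop_mult_eq_TangD by (auto simp: trop_regular_iff)
qed

theorem theorem3p7:
  fixes n :: nat and A :: "trop mat"
  assumes "n \<ge> 1" and "A \<in> carrier_mat n n"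
  shows "(pseudo_invertible n A \<longleftrightarrow> trop_regular A) \<and>
         (trop_regular A \<longrightarrow> pseudo_inverse n A (trop_adj_div_det A))"
proof -
  have "trop_regular A" if "pseudo_invertible n A"
    using that trop_regular_factor[OF assms(2)]
    by (auto simp: pseudo_invertible_def pseudo_inverse_def pseudo_units_def)
  then show ?thesis
    using pseudo_inverse_trop_adj_div_det[OF assms(2)] by (auto simp: pseudo_invertible_def)
qed

end
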